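(* Fix an integer $n>2$ and let \[\Lambda_n=\left\langle \begin{bmatrix}1 & -n\\ 0 & 1\end{bmatrix},\ \begin{bmatrix}1 & 0\\ n & 1\end{bmatrix}\right\rangle\subset \mathrm{SL}_2(\mathbb{Z}).\] The minimal spectral radius among the hyperbolic elements of $\Lambda_n$ is \[\frac{1}{2}\left(n^2+n\sqrt{n^2-4}-2\right),\] and it is attained by the matrix $\begin{bmatrix}1-n^2 & -n\\ n & 1\end{bmatrix}\in\Lambda_n$.
   Context: An element $M\in \mathrm{SL}_2(\mathbb{Z})$ is hyperbolic if $|\mathrm{tr}(M)|>2$. The spectral radius of a matrix is the maximum of the absolute values of its eigenvalues. *)

theory Defs
  imports
    "HOL-Algebra.Generated_Groups"
    "Jordan_Normal_Form.Determinant"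
    "Jordan_Normal_Form.Spectral_Radius"
begin

definition SL2Z :: "int mat monoid" where
  "SL2Z = \<lparr>partial_object.carrier = {A \<in> carrier_mat 2 2. det A = 1}, monoid.mult = (*), monoid.one = 1\<^sub>m 2\<rparr>"

lemma group_SL2Z: "group SL2Z"
proof (rule groupI)
  fix A assume "A \<in> carrier SL2Z"
  then have A: "A \<in> carrier_mat 2 2" "det A = 1"
    by (auto simp: SL2Z_def)
  have adj: "adj_mat A \<in> carrier_mat 2 2" "adj_mat A * A = 1\<^sub>m 2"
    using adj_mat[OF A(1)] A(2) by auto
  moreover have "det (adj_mat A) = 1"
    using det_mult[OF adj(1) A(1)] A(2) adj(2) by simp
  ultimately show "\<exists>B\<in>carrier SL2Z. B \<otimes>\<^bsub>SL2Z\<^esub> A = \<one>\<^bsub>SL2Z\<^esub>"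
    by (auto simp: SL2Z_def)
qed (auto simp: SL2Z_def det_mult)

definition mat2 :: "'a \<Rightarrow> 'a \<Rightarrow> 'a \<Rightarrow> 'a \<Rightarrow> 'a mat" where
  "mat2 a b c d = mat_of_rows_list 2 [[a, b], [c, d]]"

definition mat_trace :: "'a::comm_monoid_add mat \<Rightarrow> 'a" where
  "mat_trace A = sum_list (diag_mat A)"

definition hyperbolic :: "int mat \<Rightarrow> bool" where
  "hyperbolic M \<longleftrightarrow> M \<in> carrier SL2Z \<and> \<bar>mat_trace M\<bar> > 2"

text \<open>The eigenvalues of an integer matrix are its complex ones.\<close>

definition int_spectral_radius :: "int mat \<Rightarrow> real" where
  "int_spectral_radius M = spectral_radius (map_mat (of_int :: int \<Rightarrow> complex) M)"

definition Lambda :: "int \<Rightarrow> int mat set" where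
  "Lambda n = generate SL2Z {mat2 1 (-n) 0 1, mat2 1 0 n 1}"

end

theory Submission
  imports Defs
begin

text \<open>
  The spectral radius of a hyperbolic matrix with trace \<open>t\<close> is \<open>(\<bar>t\<bar> + sqrt (t\<^sup>2 - 4)) / 2\<close>, which increases
  with \<open>\<bar>t\<bar>\<close>. The diagonal entries of an element of \<open>\<Lambda>\<^sub>n\<close> are congruent to \<open>1\<close> modulo \<open>n\<^sup>2\<close>, so its
  trace is congruent to \<open>2\<close>; a hyperbolic trace is therefore not \<open>2\<close>, and the smallest remaining
  absolute value is \<open>n\<^sup>2 - 2\<close>.
\<close>

lemma mat2_carrier [simp]: "mat2 a b c d \<in> carrier_mat 2 2"
  by (rule carrier_matI) (simp_all add: mat2_def mat_of_rows_list_def)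

lemma mat2_dim [simp]: "dim_row (mat2 a b c d) = 2" "dim_col (mat2 a b c d) = 2"
  by (simp_all add: mat2_def mat_of_rows_list_def)

lemma mat2_index [simp]:
  "mat2 a b c d $$ (0, 0) = a" "mat2 a b c d $$ (0, Suc 0) = b"
  "mat2 a b c d $$ (Suc 0, 0) = c" "mat2 a b c d $$ (Suc 0, Suc 0) = d"
  by (simp_all add: mat2_def mat_of_rows_list_def)

text \<open>Reduces a matrix identity to its four entries. The later 2x2 computations rest on this,
  so that \<open>simp\<close> only meets scalar equations.\<close>

lemma mat2_eqI:
  assumes "A \<in> carrier_mat 2 2"
    and "A $$ (0, 0) = a" "A $$ (0, Suc 0) = b" "A $$ (Suc 0, 0) = c" "A $$ (Suc 0, Suc 0) = d"
  shows "A = mat2 a b c d"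
  by (rule eq_matI) (use assms in \<open>auto simp: less_2_cases_iff\<close>)

lemma carrier_mat_2E:
  assumes "A \<in> carrier_mat 2 2"
  obtains a b c d where "A = mat2 a b c d"
  using mat2_eqI[OF assms refl refl refl refl] that by blast

lemma mat2_mult:
  fixes a b c d :: "'a::semiring_0"
  shows "mat2 a b c d * mat2 a' b' c' d' =
    mat2 (a * a' + b * c') (a * b' + b * d') (c * a' + d * c') (c * b' + d * d')"
  by (rule mat2_eqI) (auto simp: scalar_prod_def numeral_2_eq_2)

lemma one_mat_2: "1\<^sub>m 2 = mat2 1 0 0 1"
  by (rule mat2_eqI) auto

lemma det_mat2: "det (mat2 a b c d) = a * d - b * c" for a :: "'a::comm_ring_1"
proof -
  have "det (mat2 a b c d) = (\<Sum>j<2. mat2 a b c d $$ (0, j) * cofactor (mat2 a b c d) 0 j)"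
    by (rule laplace_expansion_row) auto
  also have "\<dots> = a * d - b * c"
    by (simp add: numeral_2_eq_2 cofactor_def det_single mat_delete_def)
  finally show ?thesis .
qed

lemma mat_trace_mat2: "mat_trace (mat2 a b c d) = a + d"
  by (simp add: mat_trace_def diag_mat_def numeral_2_eq_2)

lemma mat2_in_SL2Z_iff: "mat2 a b c d \<in> carrier SL2Z \<longleftrightarrow> a * d - b * c = 1"
  by (simp add: SL2Z_def det_mat2)

lemma SL2Z_mult: "A \<otimes>\<^bsub>SL2Z\<^esub> B = A * B"
  by (simp add: SL2Z_def)

lemma SL2Z_one: "\<one>\<^bsub>SL2Z\<^esub> = mat2 1 0 0 1"
  by (simp add: SL2Z_def one_mat_2)

lemma SL2Z_inv:
  assumes "a * d - b * c = 1"
  shows "inv\<^bsub>SL2Z\<^esub> (mat2 a b c d) = mat2 d (- b) (- c) a"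
  by (rule group.inv_equality[OF group_SL2Z])
    (use assms in \<open>simp_all add: SL2Z_mult SL2Z_one mat2_in_SL2Z_iff mat2_mult algebra_simps\<close>)

text \<open>Matrices of this shape are closed under products: two off-diagonal entries multiply to a
  multiple of \<open>n\<^sup>2\<close>, which the diagonal absorbs, while each off-diagonal entry of
  a product keeps a factor \<open>n\<close>. Inverting a generator only flips the sign of its
  off-diagonal entry.\<close>

lemma Lambda_entries:
  assumes "M \<in> Lambda n"
  shows "\<exists>a b c d. M = mat2 (1 + n\<^sup>2 * a) (n * b) (n * c) (1 + n\<^sup>2 * d)"
  using assms unfolding Lambda_def
proof induction
  case one
  show ?case
    by (intro exI[of _ 0]) (simp add: SL2Z_one)
next
  case (incl h)
  then consider "h = mat2 1 (- n) 0 1" | "h = mat2 1 0 n 1" by blast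
  then show ?case
  proof cases
    case 1
    \<comment> \<open>Backtracking distributes the two candidate values over the four witnesses:
      \<open>b\<close> is -1 and the others are 0.\<close>
    then show ?thesis by (intro exI[of _ 0] exI[of _ "- 1"]) simp
  next
    case 2
    then show ?thesis by (intro exI[of _ 0] exI[of _ 1]) simp
  qed
next
  case (inv h)
  then consider "h = mat2 1 (- n) 0 1" | "h = mat2 1 0 n 1" by blast
  then show ?case
  proof cases
    case 1
    then have "inv\<^bsub>SL2Z\<^esub> h = mat2 (1 + n\<^sup>2 * 0) (n * 1) (n * 0) (1 + n\<^sup>2 * 0)"
      by (simp add: SL2Z_inv)
    then show ?thesis by blast
  next
    case 2
    then have "inv\<^bsub>SL2Z\<^esub> h = mat2 (1 + n\<^sup>2 * 0) (n * 0) (n * (- 1)) (1 + n\<^sup>2 * 0)"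
      by (simp add: SL2Z_inv)
    then show ?thesis by blast
  qed
next
  case (eng h1 h2)
  then obtain a b c d a' b' c' d' where
    "h1 = mat2 (1 + n\<^sup>2 * a) (n * b) (n * c) (1 + n\<^sup>2 * d)"
    "h2 = mat2 (1 + n\<^sup>2 * a') (n * b') (n * c') (1 + n\<^sup>2 * d')"
    by blast
  then have "h1 \<otimes>\<^bsub>SL2Z\<^esub> h2 =
    mat2 (1 + n\<^sup>2 * (a + a' + n\<^sup>2 * a * a' + b * c')) (n * (b' + b + n\<^sup>2 * (a * b' + b * d')))
      (n * (c + c' + n\<^sup>2 * (c * a' + d * c'))) (1 + n\<^sup>2 * (d + d' + n\<^sup>2 * d * d' + c * b'))"
    by (simp add: SL2Z_mult mat2_mult algebra_simps power2_eq_square)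
  then show ?case by blast
qed

lemma Lambda_trace:
  assumes "M \<in> Lambda n"
  obtains k where "mat_trace M = 2 + n\<^sup>2 * k"
proof -
  obtain a b c d where "M = mat2 (1 + n\<^sup>2 * a) (n * b) (n * c) (1 + n\<^sup>2 * d)"
    using Lambda_entries[OF assms] by blast
  then have "mat_trace M = 2 + n\<^sup>2 * (a + d)"
    by (simp add: mat_trace_mat2 algebra_simps)
  then show ?thesis by (rule that)
qed

lemma spectrum_mat2:
  fixes a b c d :: complex
  shows "spectrum (mat2 a b c d) = {k. k\<^sup>2 - (a + d) * k + (a * d - b * c) = 0}"
proof -
  have "char_matrix (mat2 a b c d) k = mat2 (a - k) b c (d - k)" for k
    by (rule mat2_eqI) (auto simp: char_matrix_def)
  then show ?thesis
    by (auto simp: spectrum_def eigenvalue_det[of _ 2] det_mat2 algebra_simps power2_eq_square)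
qed

text \<open>With determinant 1, the eigenvalues are the roots of k^2 - t k + 1. Its discriminant t^2
  - 4 is positive in the hyperbolic case, so both roots are real and their moduli are ordinary
  absolute values.\<close>

lemma int_spectral_radius_hyperbolic:
  assumes "hyperbolic M"
  defines "t \<equiv> real_of_int (mat_trace M)"
  shows "int_spectral_radius M = (\<bar>t\<bar> + sqrt (t\<^sup>2 - 4)) / 2"
proof -
  obtain a b c d where M: "M = mat2 a b c d"
    using assms(1) by (auto simp: hyperbolic_def SL2Z_def elim: carrier_mat_2E)
  have det: "a * d - b * c = 1" and tr: "\<bar>a + d\<bar> > 2"
    using assms(1) by (simp_all add: M hyperbolic_def mat2_in_SL2Z_iff mat_trace_mat2)
  have t: "t = real_of_int a + real_of_int d"
    by (simp add: t_def M mat_trace_mat2)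
  have "\<bar>t\<bar> > 2"
    using tr unfolding t by linarith
  then have t4: "t\<^sup>2 > 4"
    using power_strict_mono[of 2 "\<bar>t\<bar>" 2] by simp
  define s where "s = sqrt (t\<^sup>2 - 4)"
  have s: "s \<ge> 0" "s\<^sup>2 = t\<^sup>2 - 4"
    using t4 by (simp_all add: s_def)
  have "map_mat of_int M = mat2 (complex_of_int a) (of_int b) (of_int c) (of_int d)"
    unfolding M by (rule mat2_eqI) auto
  moreover have "complex_of_int a * of_int d - of_int b * of_int c = 1"
    using det by (metis of_int_1 of_int_diff of_int_mult)
  ultimately have "spectrum (map_mat of_int M) = {k. k\<^sup>2 - complex_of_real t * k + 1 = 0}"
    by (simp add: spectrum_mat2 t)
  moreover have "k\<^sup>2 - complex_of_real t * k + 1 =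
      (k - complex_of_real ((t + s) / 2)) * (k - complex_of_real ((t - s) / 2))" for k
  proof -
    \<comment> \<open>The relations between roots and coefficients are checked over the reals and
      then carried to the complex numbers, which avoids complex square roots.\<close>
    define p q where "p = (t + s) / 2" and "q = (t - s) / 2"
    have "p * q = 1" "t = p + q"
      using s(2) by (simp_all add: p_def q_def field_simps power2_eq_square)
    then have "1 = complex_of_real p * of_real q" "complex_of_real t = of_real p + of_real q"
      by (metis of_real_1 of_real_mult, simp)
    then show ?thesis
      unfolding p_def[symmetric] q_def[symmetric] by (simp add: algebra_simps power2_eq_square)
  qed
  ultimately have "spectrum (map_mat of_int M) =
      {complex_of_real ((t + s) / 2), complex_of_real ((t - s) / 2)}"
    by auto
  then have "int_spectral_radius M = max \<bar>(t + s) / 2\<bar> \<bar>(t - s) / 2\<bar>"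
    by (simp only: int_spectral_radius_def spectral_radius_def image_insert image_empty norm_of_real)
      simp
  \<comment> \<open>Since \<open>s\<close> is nonnegative, the dominant root is the one in which
    \<open>s\<close> enters with the sign of \<open>t\<close>.\<close>
  also have "\<dots> = (\<bar>t\<bar> + s) / 2"
    using s(1) by (cases "t \<ge> 0") (auto simp: max_def abs_if field_simps)
  finally show ?thesis by (simp add: s_def)
qed

text \<open>The hypothesis excludes k = 0, so the multiple of \<open>n\<^sup>2\<close> has absolute
  value at least \<open>n\<^sup>2\<close>, and adding 2 can lower this by at most 2. For n > 2 the
  bound is attained at k = -1.\<close>

lemma abs_trace_ge:
  fixes n k :: int
  assumes "\<bar>2 + n\<^sup>2 * k\<bar> > 2"
  shows "n\<^sup>2 - 2 \<le> \<bar>2 + n\<^sup>2 * k\<bar>"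
proof -
  have "k \<noteq> 0" using assms by auto
  then have "n\<^sup>2 * 1 \<le> n\<^sup>2 * \<bar>k\<bar>"
    by (intro mult_left_mono) auto
  then have "n\<^sup>2 \<le> \<bar>n\<^sup>2 * k\<bar>" by (simp add: abs_mult)
  then show ?thesis by linarith
qed

text \<open>Turns the radius for |t| = x^2 - 2 into the closed form: the radicand factors as x^2
  (x^2 - 4), and x leaves the root without a sign because it is nonnegative.\<close>

lemma sqrt_trace_formula:
  fixes x :: real
  assumes "x \<ge> 0"
  shows "(x\<^sup>2 - 2 + sqrt ((x\<^sup>2 - 2)\<^sup>2 - 4)) / 2 = 1/2 * (x\<^sup>2 + x * sqrt (x\<^sup>2 - 4) - 2)"
proof -
  have "(x\<^sup>2 - 2)\<^sup>2 - 4 = x\<^sup>2 * (x\<^sup>2 - 4)"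
    by (simp add: power2_eq_square algebra_simps)
  then have "sqrt ((x\<^sup>2 - 2)\<^sup>2 - 4) = x * sqrt (x\<^sup>2 - 4)"
    using assms by (simp add: real_sqrt_mult)
  then show ?thesis by simp
qed

theorem theorem2p1:
  fixes n :: int
  assumes "n > 2"
  shows "mat2 (1 - n^2) (-n) n 1 \<in> Lambda n
    \<and> hyperbolic (mat2 (1 - n^2) (-n) n 1)
    \<and> int_spectral_radius (mat2 (1 - n^2) (-n) n 1)
        = 1/2 * ((of_int n)^2 + of_int n * sqrt ((of_int n)^2 - 4) - 2)
    \<and> (\<forall>M\<in>Lambda n. hyperbolic M \<longrightarrow>
        1/2 * ((of_int n)^2 + of_int n * sqrt ((of_int n)^2 - 4) - 2) \<le> int_spectral_radius M)"
proof -
  let ?M = "mat2 (1 - n^2) (-n) n 1"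
  let ?x = "real_of_int n"
  have n2: "n\<^sup>2 > 4"
    using power_strict_mono[of 2 n 2] assms by simp
  then have x2: "?x\<^sup>2 > 4"
    by (metis of_int_less_iff of_int_numeral of_int_power)
  have formula: "(?x\<^sup>2 - 2 + sqrt ((?x\<^sup>2 - 2)\<^sup>2 - 4)) / 2 = 1/2 * (?x\<^sup>2 + ?x * sqrt (?x\<^sup>2 - 4) - 2)"
    using assms by (intro sqrt_trace_formula) simp
  \<comment> \<open>The extremal matrix is the product of the two generators.\<close>
  have "mat2 1 (-n) 0 1 \<otimes>\<^bsub>SL2Z\<^esub> mat2 1 0 n 1 \<in> Lambda n"
    unfolding Lambda_def by (intro generate.eng generate.incl) auto
  then have mem: "?M \<in> Lambda n"
    by (simp add: SL2Z_mult mat2_mult power2_eq_square)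
  have hyp: "hyperbolic ?M"
    using n2 by (simp add: hyperbolic_def mat2_in_SL2Z_iff mat_trace_mat2 power2_eq_square)
  \<comment> \<open>The trace is 2 - n^2, which is negative, so taking the absolute value reverses
    the difference.\<close>
  have "\<bar>real_of_int (mat_trace ?M)\<bar> = ?x\<^sup>2 - 2" "(real_of_int (mat_trace ?M))\<^sup>2 = (?x\<^sup>2 - 2)\<^sup>2"
    using x2 by (simp_all add: mat_trace_mat2 power2_commute)
  then have radius: "int_spectral_radius ?M = 1/2 * (?x\<^sup>2 + ?x * sqrt (?x\<^sup>2 - 4) - 2)"
    unfolding int_spectral_radius_hyperbolic[OF hyp] by (simp only: formula)
  have "1/2 * (?x\<^sup>2 + ?x * sqrt (?x\<^sup>2 - 4) - 2) \<le> int_spectral_radius M"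
    if M: "M \<in> Lambda n" "hyperbolic M" for M
  proof -
    obtain k where "mat_trace M = 2 + n\<^sup>2 * k"
      using M(1) by (rule Lambda_trace)
    then have "n\<^sup>2 - 2 \<le> \<bar>mat_trace M\<bar>"
      using M(2) abs_trace_ge[of n k] by (simp add: hyperbolic_def)
    then have le: "?x\<^sup>2 - 2 \<le> \<bar>real_of_int (mat_trace M)\<bar>"
      using of_int_le_iff[where 'a = real, of "n\<^sup>2 - 2" "\<bar>mat_trace M\<bar>"] by simp
    \<comment> \<open>Squaring preserves the inequality because its left side is nonnegative; then
      both summands of the radius formula can be compared separately.\<close>
    then have "(?x\<^sup>2 - 2)\<^sup>2 \<le> (real_of_int (mat_trace M))\<^sup>2"
      using x2 power_mono[OF le, of 2] by simp
    with le have "(?x\<^sup>2 - 2 + sqrt ((?x\<^sup>2 - 2)\<^sup>2 - 4)) / 2 \<le> int_spectral_radius M"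
      unfolding int_spectral_radius_hyperbolic[OF M(2)]
      by (intro divide_right_mono add_mono) auto
    then show ?thesis by (simp only: formula)
  qed
  with mem hyp radius show ?thesis by blast
qed

end
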